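(* Let $X\in\mathbb R^{n\times p}$, $Y\in\mathbb R^{n\times T}$, $\lambda>0$, let $\hat B$ be the multi-task Lasso estimator and assume that all its rows are nonzero, i.e. $\hat S=\{1,\dots,p\}$ (so that $X_{\hat S}=X$). Let $v\in\mathbb R^{|\hat S|}$ have entries $v_j=nT\lambda\|\hat B^\top e_j\|_2^{-1}$ and, for $j\in\hat S$, let $b^{(j)}=(nT\lambda\|\hat B^\top e_j\|_2^{-3})^{1/2}\,\hat B^\top e_j\in\mathbb R^T$. If the matrix $P=(P_{jk})_{(j,k)\in\hat S\times\hat S}$ with $$P_{jk}=-I\{j=k\}+\big(b^{(j)\top}b^{(k)}\big)\,\big(e_j^\top(X_{\hat S}^\top X_{\hat S}+\operatorname{diag}(v))^{-1}e_k\big)$$ is invertible, then $$\hat A=\operatorname{Tr}\Big[X_{\hat S}^\top X_{\hat S}\big(X_{\hat S}^\top X_{\hat S}+\operatorname{diag}(v)\big)^{-1}\Big]I_{T\times T}-\sum_{j\in\hat S}b^{(j)}\sum_{k\in\hat S}(e_j^\top Qe_k)(e_j^\top P^{-1}e_k)\,b^{(k)\top},$$ where $$Q=\big(X_{\hat S}^\top X_{\hat S}+\operatorname{diag}(v)\big)^{-1}X_{\hat S}^\top X_{\hat S}\big(X_{\hat S}^\top X_{\hat S}+\operatorname{diag}(v)\big)^{-1}.$$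
   Context: Notation: $e_j$ denotes canonical basis vectors, $\|\cdot\|_F$ the Frobenius norm, $\|B\|_{2,1}=\sum_{j=1}^p\|B^\top e_j\|_2$ for $B\in\mathbb R^{p\times T}$, $\otimes$ the Kronecker product, $\dagger$ the Moore–Penrose inverse, $I\{\cdot\}$ the indicator, $\operatorname{diag}(v)$ the diagonal matrix with diagonal $v$. Multi-task Lasso: $\hat B=\operatorname{argmin}_{B\in\mathbb R^{p\times T}}\big(\frac1{2nT}\|Y-XB\|_F^2+\lambda\|B\|_{2,1}\big)$. Interaction matrix: let $\hat S=\{j\in\{1,\dots,p\}:\hat B^\top e_j\ne0\}$; let $X_{\hat S}\in\mathbb R^{n\times p}$ be $X$ with the columns not indexed by $\hat S$ replaced by zero; $\tilde X=I_{T\times T}\otimes X_{\hat S}$; for $j\in\hat S$, $H^{(j)}=\lambda\|\hat B^\top e_j\|_2^{-1}\big(I_{T\times T}-\hat B^\top e_je_j^\top\hat B\,\|\hat B^\top e_j\|_2^{-2}\big)\in\mathbb R^{T\times T}$; $\tilde H=\sum_{j\in\hat S}H^{(j)}\otimes(e_je_j^\top)\in\mathbb R^{pT\times pT}$. The matrix $\hat A\in\mathbb R^{T\times T}$ has entries $\hat A_{tt'}=\operatorname{Tr}\big[(e_t^\top\otimes X_{\hat S})(\tilde X^\top\tilde X+nT\tilde H)^\dagger(e_{t'}\otimes X_{\hat S}^\top)\big]$. *)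

theory Defs
  imports "HOL-Analysis.Analysis"
begin

text \<open>
  A matrix in $\mathbb{R}^{a \times b}$ has type \<open>real^'b^'a\<close> (rows outermost). The sample
  size $n$, the number of features $p$ and the number of tasks $T$ are the cardinalities of
  the index types \<open>'n\<close>, \<open>'p\<close>, \<open>'t\<close>; the canonical basis vector $e_j$ is \<open>axis j 1\<close>.
\<close>

section \<open>Matrix notions\<close>

definition diag :: "real^'a \<Rightarrow> real^'a^'a" where
  "diag v = (\<chi> i j. if i = j then v $ i else 0)"

text \<open>The rank-one matrix $u w^\top$.\<close>

definition outer :: "real^'a \<Rightarrow> real^'b \<Rightarrow> real^'b^'a" where
  "outer u w = (\<chi> i j. u $ i * w $ j)"

text \<open>
  Block index first, index within the block second: the row $(i-1)c+k$ of the usual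
  Kronecker product of $A$ with a matrix with $c$ rows corresponds to the pair \<open>(i, k)\<close>.
\<close>

definition kron :: "real^'b^'a \<Rightarrow> real^'d^'c \<Rightarrow> real^('b \<times> 'd)^('a \<times> 'c)"
    (infixl \<open>\<otimes>\<^sub>K\<close> 75) where
  "A \<otimes>\<^sub>K B = (\<chi> i j. A $ fst i $ fst j * B $ snd i $ snd j)"

definition is_moore_penrose :: "real^'b^'a \<Rightarrow> real^'a^'b \<Rightarrow> bool" where
  "is_moore_penrose A M \<longleftrightarrow>
     A ** M ** A = A \<and> M ** A ** M = M \<and>
     transpose (A ** M) = A ** M \<and> transpose (M ** A) = M ** A"

definition pinv :: "real^'b^'a \<Rightarrow> real^'a^'b" where
  "pinv A = (THE M. is_moore_penrose A M)"

lemma is_moore_penrose_unique: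
  assumes M: "is_moore_penrose A M" and N: "is_moore_penrose A N"
  shows "M = N"
proof -
  note m = M[unfolded is_moore_penrose_def] and n = N[unfolded is_moore_penrose_def]
  have AM: "A ** M = A ** N"
  proof -
    have "A ** M = transpose (A ** N ** A ** M)"
      using m n by simp
    also have "\<dots> = transpose (A ** M) ** transpose (A ** N)"
      by (simp only: matrix_transpose_mul[symmetric] matrix_mul_assoc)
    also have "\<dots> = A ** N"
      using m n by (simp add: matrix_mul_assoc)
    finally show ?thesis .
  qed
  have MA: "M ** A = N ** A"
  proof -
    have "M ** A = transpose (M ** (A ** N ** A))"
      using m n by simp
    also have "\<dots> = transpose (N ** A) ** transpose (M ** A)"
      by (simp only: matrix_transpose_mul[symmetric] matrix_mul_assoc)
    also have "\<dots> = (N ** A) ** (M ** A)"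
      using m n by simp
    also have "\<dots> = N ** (A ** M ** A)"
      by (simp only: matrix_mul_assoc)
    also have "\<dots> = N ** A"
      using m by simp
    finally show ?thesis .
  qed
  have "M = M ** A ** M" using m by simp
  also have "\<dots> = N ** A ** N" by (metis AM MA matrix_mul_assoc)
  also have "\<dots> = N" using n by simp
  finally show ?thesis .
qed

text \<open>The library norm on matrices is the Frobenius norm.\<close>

lemma norm_matrix_eq_frobenius:
  fixes A :: "real^'b^'a"
  shows "norm A = sqrt (\<Sum>i\<in>UNIV. \<Sum>j\<in>UNIV. (A $ i $ j)\<^sup>2)"
  by (simp add: norm_vec_def L2_set_def sum_nonneg)

definition norm21 :: "real^'t^'p \<Rightarrow> real" where
  "norm21 B = (\<Sum>j\<in>UNIV. norm (transpose B *v axis j 1))"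


section \<open>Multi-task Lasso\<close>

definition mtl_objective :: "real^'p^'n \<Rightarrow> real^'t^'n \<Rightarrow> real \<Rightarrow> real^'t^'p \<Rightarrow> real" where
  "mtl_objective X Y lam B =
     1 / (2 * real CARD('n) * real CARD('t)) * (norm (Y - X ** B))\<^sup>2 + lam * norm21 B"

text \<open>
  A predicate rather than a function, because the minimizer need not be unique when the
  columns of $X$ are linearly dependent.
\<close>

definition is_mtl_estimator :: "real^'p^'n \<Rightarrow> real^'t^'n \<Rightarrow> real \<Rightarrow> real^'t^'p \<Rightarrow> bool" where
  "is_mtl_estimator X Y lam B \<longleftrightarrow> is_arg_min (mtl_objective X Y lam) (\<lambda>_. True) B"

definition row_support :: "real^'t^'p \<Rightarrow> 'p set" where
  "row_support B = {j. transpose B *v axis j 1 \<noteq> 0}"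

definition restrict_cols :: "real^'p^'n \<Rightarrow> 'p set \<Rightarrow> real^'p^'n" where
  "restrict_cols X S = (\<chi> i j. if j \<in> S then X $ i $ j else 0)"


section \<open>Interaction matrix\<close>

definition X_tilde :: "real^'p^'n \<Rightarrow> real^'t^'p \<Rightarrow> real^('t \<times> 'p)^('t \<times> 'n)" where
  "X_tilde X B = (mat 1 :: real^'t^'t) \<otimes>\<^sub>K restrict_cols X (row_support B)"

definition H_row :: "real \<Rightarrow> real^'t^'p \<Rightarrow> 'p \<Rightarrow> real^'t^'t" where
  "H_row lam B j =
     (let r = transpose B *v axis j 1
      in (lam * inverse (norm r)) *\<^sub>R (mat 1 - inverse ((norm r)\<^sup>2) *\<^sub>R outer r r))"

definition H_tilde :: "real \<Rightarrow> real^'t^'p \<Rightarrow> real^('t \<times> 'p)^('t \<times> 'p)" where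
  "H_tilde lam B = (\<Sum>j\<in>row_support B. H_row lam B j \<otimes>\<^sub>K outer (axis j 1) (axis j 1))"

text \<open>
  Here $e_t^\top$ and $e_{t'}$ are matrices with a single row, respectively column, indexed by
  the one-element type \<open>1\<close>.
\<close>

definition interaction_matrix :: "real^'p^'n \<Rightarrow> real \<Rightarrow> real^'t^'p \<Rightarrow> real^'t^'t" where
  "interaction_matrix X lam B =
     (\<chi> t t'.
        let XS = restrict_cols X (row_support B);
            Xt = X_tilde X B;
            G = transpose Xt ** Xt + (real CARD('n) * real CARD('t)) *\<^sub>R H_tilde lam B
        in trace (((rowvector (axis t 1) :: real^'t^1) \<otimes>\<^sub>K XS) ** pinv G **
                  ((columnvector (axis t' 1) :: real^1^'t) \<otimes>\<^sub>K transpose XS)))"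

end

theory Submission
  imports Defs
begin

text \<open>
  With full row support, the matrix inverted in the definition of $\hat A$ is
  $I_T \otimes M - U U^\top$ with $M = X^\top X + \mathrm{diag}(v)$ positive definite and
  $U$ the matrix whose $j$-th column is $b^{(j)} \otimes e_j$. The Woodbury identity, with
  capacitance matrix $I - U^\top (I_T \otimes M^{-1}) U = -P$, gives
  $K - K U P^{-1} U^\top K$ with $K = I_T \otimes M^{-1}$ for its inverse, and the formula
  is the trace of the resulting product.
\<close>

section \<open>Matrix algebra\<close>

lemma matrix_diff_ldistrib:
  fixes A :: "real^'b^'a" and B C :: "real^'c^'b"
  shows "A ** (B - C) = A ** B - A ** C"
  by (simp add: vec_eq_iff matrix_matrix_mult_def algebra_simps sum_subtractf)

lemma matrix_diff_rdistrib:
  fixes A B :: "real^'b^'a" and C :: "real^'c^'b"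
  shows "(A - B) ** C = A ** C - B ** C"
  by (simp add: vec_eq_iff matrix_matrix_mult_def algebra_simps sum_subtractf)

lemma matrix_add_rdistrib:
  fixes A B :: "real^'b^'a" and C :: "real^'c^'b"
  shows "(A + B) ** C = A ** C + B ** C"
  by (simp add: vec_eq_iff matrix_matrix_mult_def algebra_simps sum.distrib)

lemma matrix_inv_inverse:
  fixes A :: "real^'a^'a"
  assumes "invertible A"
  shows "A ** matrix_inv A = mat 1" "matrix_inv A ** A = mat 1"
proof -
  have "A ** matrix_inv A = mat 1 \<and> matrix_inv A ** A = mat 1"
    using assms unfolding invertible_def matrix_inv_def by (rule someI_ex)
  then show "A ** matrix_inv A = mat 1" "matrix_inv A ** A = mat 1" by blast+
qed

text \<open>One side is a left inverse of \<open>transpose A\<close>, the other a right inverse, so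
  they agree by associativity.\<close>

lemma transpose_matrix_inv:
  fixes A :: "real^'a^'a"
  assumes "invertible A"
  shows "transpose (matrix_inv A) = matrix_inv (transpose A)"
proof -
  have "transpose (matrix_inv A) ** transpose A = mat 1"
    by (metis assms matrix_inv_inverse(1) matrix_transpose_mul transpose_mat)
  moreover have "transpose A ** matrix_inv (transpose A) = mat 1"
    by (simp add: assms matrix_inv_inverse(1) transpose_invertible)
  ultimately show ?thesis
    by (metis matrix_mul_assoc matrix_mul_lid matrix_mul_rid)
qed

lemma matrix_entry_inner_axis:
  fixes A :: "real^'b^'a"
  shows "axis i 1 \<bullet> (A *v axis j 1) = A $ i $ j"
  by (simp add: inner_axis' matrix_vector_mult_basis column_def)

lemma gram_entry:
  fixes A :: "real^'b^'a"
  shows "(transpose A ** A) $ j $ k = (\<Sum>i\<in>UNIV. A $ i $ j * A $ i $ k)"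
  by (simp add: matrix_matrix_mult_def transpose_def)

text \<open>Expands the trace into entries of \<open>R\<close> weighted by inner products of columns
  of \<open>A\<close> and \<open>C\<close>. This turns the Woodbury correction term into the double
  sum over \<open>j\<close> and \<open>k\<close>.\<close>

lemma trace_mult_transpose:
  fixes A C :: "real^'b^'a" and R :: "real^'b^'b"
  shows "trace (A ** R ** transpose C)
    = (\<Sum>j\<in>UNIV. \<Sum>k\<in>UNIV. R $ j $ k * (\<Sum>i\<in>UNIV. A $ i $ j * C $ i $ k))"
proof -
  have "trace (A ** R ** transpose C)
      = (\<Sum>i\<in>UNIV. \<Sum>k\<in>UNIV. \<Sum>j\<in>UNIV. R $ j $ k * (A $ i $ j * C $ i $ k))"
    by (simp add: trace_def matrix_matrix_mult_def transpose_def sum_distrib_left mult_ac)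
  also have "\<dots> = (\<Sum>k\<in>UNIV. \<Sum>i\<in>UNIV. \<Sum>j\<in>UNIV. R $ j $ k * (A $ i $ j * C $ i $ k))"
    by (rule sum.swap)
  also have "\<dots> = (\<Sum>k\<in>UNIV. \<Sum>j\<in>UNIV. \<Sum>i\<in>UNIV. R $ j $ k * (A $ i $ j * C $ i $ k))"
    by (intro sum.cong refl sum.swap)
  also have "\<dots> = (\<Sum>j\<in>UNIV. \<Sum>k\<in>UNIV. \<Sum>i\<in>UNIV. R $ j $ k * (A $ i $ j * C $ i $ k))"
    by (rule sum.swap)
  finally show ?thesis
    by (simp add: sum_distrib_left)
qed

lemma transpose_mult_axis:
  fixes A :: "real^'b^'a"
  shows "transpose A *v axis j 1 = A $ j"
  by (simp add: vec_eq_iff matrix_vector_mult_basis column_def transpose_def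
      del: transpose_matrix_vector)

text \<open>For square matrices a right inverse is two-sided. Both products are then the identity,
  and the four Penrose equations hold trivially.\<close>

lemma pinv_eq_inverse:
  fixes A M :: "real^'a^'a"
  assumes "A ** M = mat 1"
  shows "pinv A = M"
proof -
  have "M ** A = mat 1"
    using assms by (simp add: matrix_left_right_inverse)
  then have "is_moore_penrose A M"
    using assms by (simp add: is_moore_penrose_def)
  then show ?thesis
    unfolding pinv_def using is_moore_penrose_unique by blast
qed

text \<open>The quadratic form at \<open>x\<close> is the squared norm of \<open>X *v x\<close> plus
  a sum of squares with the positive weights \<open>v $ j\<close>. It vanishes only at zero, so the
  kernel is trivial.\<close>

lemma invertible_gram_plus_diag:
  fixes X :: "real^'p^'n" and v :: "real^'p"
  assumes "\<And>j. v $ j > 0"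
  shows "invertible (transpose X ** X + diag v)"
proof -
  have "x = 0" if "(transpose X ** X + diag v) *v x = 0" for x
  proof -
    have D: "diag v *v x = (\<chi> j. v $ j * x $ j)"
      by (simp add: diag_def matrix_vector_mult_def vec_eq_iff if_distrib[of "\<lambda>y. y * _"]
          cong: if_cong)
    have G: "x \<bullet> ((transpose X ** X) *v x) = (X *v x) \<bullet> (X *v x)"
      by (metis dot_lmul_matrix inner_commute matrix_vector_mul_assoc transpose_matrix_vector)
    have "0 = x \<bullet> ((transpose X ** X + diag v) *v x)"
      using that by simp
    also have "\<dots> = (X *v x) \<bullet> (X *v x) + (\<Sum>j\<in>UNIV. v $ j * (x $ j)\<^sup>2)"
      by (simp add: matrix_vector_mult_add_rdistrib inner_add_right G)
        (simp add: D inner_vec_def power2_eq_square mult_ac)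
    finally have "(\<Sum>j\<in>UNIV. v $ j * (x $ j)\<^sup>2) \<le> 0"
      using inner_ge_zero[of "X *v x"] by linarith
    then have "\<forall>j\<in>UNIV. v $ j * (x $ j)\<^sup>2 = 0"
      using assms
      by (subst sum_nonneg_eq_0_iff[symmetric])
        (auto intro!: antisym sum_nonneg simp: less_imp_le)
    then show "x = 0"
      using assms by (simp add: vec_eq_iff) (metis less_irrefl)
  qed
  then show ?thesis
    by (simp add: invertible_left_inverse matrix_left_invertible_ker)
qed

text \<open>Here \<open>P\<close> is minus the usual capacitance matrix, which is why the correction
  to \<open>K\<close> is subtracted.\<close>

lemma woodbury_identity:
  fixes D K :: "real^'a^'a" and U :: "real^'b^'a" and V :: "real^'a^'b" and P R :: "real^'b^'b"
  assumes K: "D ** K = mat 1"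
    and P: "P = V ** K ** U - mat 1"
    and R: "P ** R = mat 1"
  shows "(D - U ** V) ** (K - K ** U ** R ** V ** K) = mat 1"
proof -
  have DK: "D ** (K ** U ** R ** V ** K) = U ** R ** V ** K"
    by (metis K matrix_mul_assoc matrix_mul_lid)
  \<comment> \<open>\<open>V ** K ** U\<close> equals \<open>P + mat 1\<close>, and \<open>R\<close>
    is a right inverse of \<open>P\<close>. The two resulting terms cancel the cross terms of the
    product.\<close>
  have "V ** K ** U ** R = mat 1 + R"
    using R unfolding P by (simp add: matrix_diff_rdistrib algebra_simps)
  then have "U ** V ** (K ** U ** R ** V ** K) = U ** (mat 1 + R) ** (V ** K)"
    by (metis matrix_mul_assoc)
  also have "\<dots> = U ** V ** K + U ** R ** V ** K"
    by (simp add: matrix_add_ldistrib matrix_add_rdistrib matrix_mul_assoc)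
  finally show ?thesis
    by (simp add: matrix_diff_ldistrib matrix_diff_rdistrib K DK)
qed

section \<open>Kronecker products\<close>

lemma sum_UNIV_prod: "(\<Sum>z\<in>UNIV. f z) = (\<Sum>x\<in>UNIV. \<Sum>y\<in>UNIV. f (x, y))"
  for f :: "'a::finite \<times> 'b::finite \<Rightarrow> real"
  by (simp add: sum.cartesian_product)

lemma kron_mult:
  fixes A :: "real^'b^'a" and B :: "real^'e^'d" and C :: "real^'c^'b" and D :: "real^'f^'e"
  shows "(A \<otimes>\<^sub>K B) ** (C \<otimes>\<^sub>K D) = (A ** C) \<otimes>\<^sub>K (B ** D)"
  by (simp add: kron_def vec_eq_iff matrix_matrix_mult_def sum_UNIV_prod sum_product mult_ac)

lemma transpose_kron: "transpose (A \<otimes>\<^sub>K B) = transpose A \<otimes>\<^sub>K transpose B"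
  by (simp add: kron_def vec_eq_iff transpose_def)

lemma kron_mat_1: "(mat 1 :: real^'a^'a) \<otimes>\<^sub>K (mat 1 :: real^'b^'b) = mat 1"
  by (simp add: kron_def vec_eq_iff mat_def prod_eq_iff)

lemma trace_kron:
  fixes A :: "real^'a^'a" and B :: "real^'b^'b"
  shows "trace (A \<otimes>\<^sub>K B) = trace A * trace B"
  by (simp add: trace_def kron_def sum_UNIV_prod sum_product)

section \<open>The interaction matrix\<close>

text \<open>Column \<open>j\<close> is the Kronecker product of \<open>b j\<close> with the basis
  vector \<open>axis j 1\<close>; the row index is a pair (task, feature), as in
  \<open>X_tilde\<close>.\<close>

definition block_columns :: "('p \<Rightarrow> real^'t) \<Rightarrow> real^'p^('t \<times> 'p)" where
  "block_columns b = (\<chi> i j. if snd i = j then b j $ fst i else 0)"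

lemma kron_mult_block_columns:
  fixes b :: "'p::finite \<Rightarrow> real^'t" and A :: "real^'t^'s" and C :: "real^'p^'n"
  shows "(A \<otimes>\<^sub>K C) ** block_columns b = (\<chi> i j. (A *v b j) $ fst i * C $ snd i $ j)"
  by (simp add: vec_eq_iff matrix_matrix_mult_def matrix_vector_mult_def block_columns_def
      kron_def sum_UNIV_prod sum_distrib_left if_distrib[of "\<lambda>y. _ * y"] mult_ac cong: if_cong)

text \<open>The bilinear form of a Kronecker product factors on Kronecker vectors: one factor comes
  from the tasks, the other from the features. This is the origin of the entrywise product in
  \<open>P\<close>.\<close>

lemma transpose_block_columns_kron:
  fixes b :: "'p::finite \<Rightarrow> real^'t" and N :: "real^'p^'p"
  shows "transpose (block_columns b) ** (mat 1 \<otimes>\<^sub>K N) ** block_columns b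
    = (\<chi> j k. (b j \<bullet> b k) * N $ j $ k)"
  unfolding matrix_mul_assoc[symmetric] kron_mult_block_columns
  by (simp add: vec_eq_iff matrix_matrix_mult_def block_columns_def transpose_def
      sum_UNIV_prod inner_vec_def sum_distrib_left if_distrib[of "\<lambda>y. y * _"]
      if_distrib[of "\<lambda>y. _ * y"] mult_ac cong: if_cong)

text \<open>Both regularization terms are block diagonal with respect to the feature index. The
  scalar part of each \<open>H_row\<close> yields \<open>diag v\<close>, and its rank-one part
  yields the outer product of \<open>b j\<close> with itself.\<close>

lemma regularized_gram_decomposition:
  fixes X :: "real^'p^'n" and B :: "real^'t^'p"
  assumes lam: "lam > 0" and full: "row_support B = UNIV"
    and v: "\<And>j. v $ j = real CARD('n) * real CARD('t) * lam * inverse (norm (B $ j))"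
    and b: "\<And>j. b j = sqrt (real CARD('n) * real CARD('t) * lam * inverse (norm (B $ j) ^ 3))
                      *\<^sub>R B $ j"
  shows "transpose (X_tilde X B) ** X_tilde X B
           + (real CARD('n) * real CARD('t)) *\<^sub>R H_tilde lam B
         = mat 1 \<otimes>\<^sub>K (transpose X ** X + diag v)
           - block_columns b ** transpose (block_columns b)"
proof -
  have X: "restrict_cols X (row_support B) = X"
    by (simp add: full restrict_cols_def vec_eq_iff)
  have gram: "transpose (X_tilde X B) ** X_tilde X B = mat 1 \<otimes>\<^sub>K (transpose X ** X)"
    by (simp add: X_tilde_def X transpose_kron kron_mult)
  have H: "H_tilde lam B $ (s, i) $ (t, j) = (if i = j then H_row lam B i $ s $ t else 0)"
    for s t i j
    by (simp add: H_tilde_def full kron_def outer_def axis_def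
        if_distrib[of "\<lambda>y. y * _"] if_distrib[of "\<lambda>y. _ * y"] cong: if_cong)
  have UU: "(block_columns b ** transpose (block_columns b)) $ (s, i) $ (t, j)
      = (if i = j then b i $ s * b i $ t else 0)" for s t i j
    by (simp add: block_columns_def transpose_def matrix_matrix_mult_def
        if_distrib[of "\<lambda>y. y * _"] if_distrib[of "\<lambda>y. _ * y"] cong: if_cong)
  have bb: "b i $ s * b i $ t = real CARD('n) * real CARD('t) * lam
      * inverse (norm (B $ i) ^ 3) * (B $ i $ s * B $ i $ t)" for i s t
  proof -
    have "sqrt c * x * (sqrt c * y) = c * (x * y)" if "c \<ge> 0" for c x y :: real
      using that by (metis mult.assoc mult.left_commute real_sqrt_mult_self abs_of_nonneg)
    then show ?thesis
      using lam by (simp add: b)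
  qed
  \<comment> \<open>The cubed norm in \<open>b\<close> combines the factor
    \<open>inverse (norm r)\<close> in front of \<open>H_row\<close> with the
    \<open>inverse ((norm r)\<^sup>2)\<close> of its projection.\<close>
  have "(real CARD('n) * real CARD('t)) * H_row lam B i $ s $ t
      = (if s = t then v $ i else 0) - b i $ s * b i $ t" for i s t
    unfolding bb
    by (simp add: H_row_def Let_def transpose_mult_axis v mat_def outer_def power3_eq_cube
        power2_eq_square algebra_simps del: transpose_matrix_vector)
  then show ?thesis
    unfolding gram
    by (auto simp: vec_eq_iff H UU kron_def mat_def diag_def)
qed

theorem proposition5p1:
  fixes X :: "real^'p^'n" and Y :: "real^'t^'n" and lam :: real and B :: "real^'t^'p"
    and S :: "'p set" and XS :: "real^'p^'n"
    and v :: "real^'p" and b :: "'p \<Rightarrow> real^'t" and N P Q :: "real^'p^'p"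
  assumes lam: "lam > 0"
    and B: "is_mtl_estimator X Y lam B"
    and S: "S = row_support B"
    and all_rows: "S = UNIV"
    and XS: "XS = restrict_cols X S"
    and v: "v = (\<chi> j. real CARD('n) * real CARD('t) * lam
                       * inverse (norm (transpose B *v axis j 1)))"
    and b: "\<And>j. j \<in> S \<Longrightarrow>
              b j = sqrt (real CARD('n) * real CARD('t) * lam
                          * inverse (norm (transpose B *v axis j 1) ^ 3))
                    *\<^sub>R (transpose B *v axis j 1)"
    and N: "N = matrix_inv (transpose XS ** XS + diag v)"
    and P: "P = (\<chi> j k. - (if j = k then 1 else 0)
                         + (b j \<bullet> b k) * (axis j 1 \<bullet> (N *v axis k 1)))"
    and P_inv: "invertible P"
    and Q: "Q = N ** (transpose XS ** XS) ** N"
  shows "interaction_matrix X lam B =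
           trace (transpose XS ** XS ** N) *\<^sub>R mat 1
           - (\<Sum>j\<in>S. \<Sum>k\<in>S.
                ((axis j 1 \<bullet> (Q *v axis k 1)) * (axis j 1 \<bullet> (matrix_inv P *v axis k 1)))
                *\<^sub>R outer (b j) (b k))"
proof -
  note simps = transpose_mult_axis matrix_entry_inner_axis
  have full: "row_support B = UNIV"
    using S all_rows by simp
  have X: "restrict_cols X (row_support B) = X" "XS = X"
    by (simp_all add: full XS S restrict_cols_def vec_eq_iff)
  have row: "B $ j \<noteq> 0" for j
    using full unfolding row_support_def simps by auto
  define M where "M = transpose X ** X + diag v"
  have "v $ j > 0" for j
    using lam row by (simp add: v simps del: transpose_matrix_vector)
  then have M: "invertible M"
    unfolding M_def by (rule invertible_gram_plus_diag)
  have NM: "N = matrix_inv M"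
    by (simp add: N M_def X)
  have "transpose M = M"
    by (auto simp: M_def diag_def transpose_def matrix_matrix_mult_def vec_eq_iff mult_ac)
  then have N_sym: "transpose N = N"
    using transpose_matrix_inv[OF M] by (simp add: NM)
  define U where "U = block_columns b"
  define K where "K = (mat 1 :: real^'t^'t) \<otimes>\<^sub>K N"
  define R where "R = matrix_inv P"
  define G where "G = transpose (X_tilde X B) ** X_tilde X B
    + (real CARD('n) * real CARD('t)) *\<^sub>R H_tilde lam B"
  have G: "G = mat 1 \<otimes>\<^sub>K M - U ** transpose U"
    unfolding G_def M_def U_def
    using b by (intro regularized_gram_decomposition lam full)
      (simp_all add: v all_rows simps del: transpose_matrix_vector)
  have P_eq: "P = transpose U ** K ** U - mat 1"
    unfolding U_def K_def transpose_block_columns_kron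
    by (simp add: P simps mat_def vec_eq_iff)
  have "P ** R = mat 1"
    unfolding R_def using P_inv by (rule matrix_inv_inverse)
  \<comment> \<open>By the mixed-product rule, inverting the block diagonal matrix reduces to
    inverting \<open>M\<close>.\<close>
  moreover have "mat 1 \<otimes>\<^sub>K M ** K = mat 1"
    by (simp add: K_def NM kron_mult kron_mat_1 matrix_inv_inverse M)
  ultimately have "G ** (K - K ** U ** R ** transpose U ** K) = mat 1"
    unfolding G using P_eq by (intro woodbury_identity)
  then have pinv_G: "pinv G = K - K ** U ** R ** transpose U ** K"
    by (rule pinv_eq_inverse)
  have K_sym: "transpose K = K"
    by (simp add: K_def transpose_kron N_sym)
  \<comment> \<open>Symmetry of \<open>N\<close> makes \<open>Q\<close> the Gram matrix of
    \<open>X ** N\<close>, so its entries are the column inner products that appear in the trace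
    expansion.\<close>
  have Q_entry: "Q $ j $ k = (\<Sum>i\<in>UNIV. (X ** N) $ i $ j * (X ** N) $ i $ k)" for j k
  proof -
    have "Q = transpose (X ** N) ** (X ** N)"
      by (simp add: Q X matrix_transpose_mul N_sym matrix_mul_assoc)
    then show ?thesis
      by (simp add: gram_entry)
  qed
  have "interaction_matrix X lam B $ t $ t' =
      (if t = t' then trace (transpose X ** X ** N) else 0)
      - (\<Sum>j\<in>UNIV. \<Sum>k\<in>UNIV. Q $ j $ k * R $ j $ k * (b j $ t * b k $ t'))" for t t'
  proof -
    define E where "E s = (rowvector (axis s 1) :: real^'t^1) \<otimes>\<^sub>K X" for s
    \<comment> \<open>Column \<open>j\<close> is the scalar \<open>b j $ s\<close> times column
      \<open>j\<close> of \<open>X ** N\<close>. The first component of \<open>i\<close> lies in the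
      one-element type, so only \<open>snd i\<close> matters.\<close>
    have EKU: "(E s ** K ** U) $ i $ j = b j $ s * (X ** N) $ snd i $ j" for s i j
      by (simp add: E_def K_def U_def kron_mult kron_mult_block_columns matrix_vector_mult_def
          rowvector_def axis_def if_distrib[of "\<lambda>y. y * _"] cong: if_cong)
    have "interaction_matrix X lam B $ t $ t' = trace (E t ** pinv G ** transpose (E t'))"
      by (simp add: interaction_matrix_def Let_def X E_def G_def transpose_kron
          transpose_rowvector)
    \<comment> \<open>Symmetry of \<open>K\<close> lets the right half of the correction be read as
      the transpose of \<open>E t' ** K ** U\<close>.\<close>
    also have "\<dots> = trace (E t ** K ** transpose (E t'))
        - trace ((E t ** K ** U) ** R ** transpose (E t' ** K ** U))"
      by (simp add: pinv_G matrix_diff_ldistrib matrix_diff_rdistrib trace_sub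
          matrix_transpose_mul K_sym matrix_mul_assoc)
    \<comment> \<open>The trace of a Kronecker product is the product of the traces. The task factor
      is the inner product of two basis vectors, and cyclicity brings the feature factor to the
      stated form.\<close>
    also have "trace (E t ** K ** transpose (E t'))
        = (if t = t' then trace (transpose X ** X ** N) else 0)"
    proof -
      have "trace (rowvector (axis t 1) ** columnvector (axis t' 1) :: real^1^1)
          = (if t = t' then 1 else 0)"
        by (simp add: trace_def matrix_matrix_mult_def rowvector_def columnvector_def axis_def
            sum_1 if_distrib[of "\<lambda>y. y * _"] cong: if_cong)
      moreover have "trace (X ** N ** transpose X) = trace (transpose X ** X ** N)"
        by (metis trace_mul_sym matrix_mul_assoc)
      ultimately show ?thesis
        by (simp add: E_def K_def transpose_kron kron_mult trace_kron transpose_rowvector)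
    qed
    also have "trace ((E t ** K ** U) ** R ** transpose (E t' ** K ** U))
        = (\<Sum>j\<in>UNIV. \<Sum>k\<in>UNIV. Q $ j $ k * R $ j $ k * (b j $ t * b k $ t'))"
      by (simp add: trace_mult_transpose EKU sum_UNIV_prod sum_1 Q_entry sum_distrib_left
          sum_distrib_right mult_ac)
    finally show ?thesis .
  qed
  then show ?thesis
    by (auto simp: vec_eq_iff all_rows simps outer_def mat_def X R_def[symmetric])
qed

end
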